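(* Let $d\ge 1$ be an integer, let $\bm{y}=(y_1,\dots,y_d)^{\mathrm T}\sim\mathcal{N}(\bar{\bm{y}},\bm{\Sigma}_y)$ be an $\mathbb{R}^d$-valued Gaussian random vector with mean $\bar{\bm{y}}$ and covariance matrix $\bm{\Sigma}_y$, and let $\beta\in(0,1)$. Let $\bm{\sigma}_y\in\mathbb{R}^d$ be the vector whose $i$-th component is $\sigma_{y,i}=\sqrt{(\bm{\Sigma}_y)_{i,i}}$. If $$\bar{\bm{y}}+\Psi_d^{-1}(\beta)\,\bm{\sigma}_y\preceq\bm{0},$$ then $$\mathbb{P}(\bm{y}\preceq\bm{0})\ge 1-\beta .$$
   Context: For $\bm{a},\bm{b}\in\mathbb{R}^d$, $\bm{a}\preceq\bm{b}$ means $a_i\le b_i$ for all $i\in\{1,\dots,d\}$. $\Phi_d$ denotes the cumulative distribution function of the chi-squared distribution with $d$ degrees of freedom, $\Phi_d^{-1}$ its inverse, and $\Psi_d^{-1}(\beta)=\sqrt{\Phi_d^{-1}(1-\beta)}$. *)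

theory Defs
  imports "HOL-Probability.Probability"
begin

definition std_normal_vec :: "(real ^ 'n) measure"
  where "std_normal_vec = distr (\<Pi>\<^sub>M i\<in>UNIV. std_normal_distribution) borel (\<lambda>z. \<chi> i. z i)"

text \<open>
  The random vector \<open>y\<close> has the law \<open>N(\<mu>, \<Sigma>)\<close> if it is distributed as \<open>\<mu> + A z\<close>, where \<open>z\<close> is a
  standard normal vector and \<open>A A\<^sup>T = \<Sigma>\<close>.  Singular \<open>\<Sigma>\<close> is allowed.  Symmetry and positive
  semidefiniteness of \<open>\<Sigma>\<close> are implied; conversely each such \<open>\<Sigma>\<close> has a square factor \<open>A\<close>.  That
  \<open>\<mu>\<close> and \<open>\<Sigma>\<close> are the mean vector and covariance matrix of \<open>y\<close> is proved in
  \<open>has_normal_law_mean\<close> and \<open>has_normal_law_covariance\<close>.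
\<close>

definition has_normal_law ::
    "'w measure \<Rightarrow> ('w \<Rightarrow> real ^ 'n) \<Rightarrow> real ^ 'n \<Rightarrow> real ^ 'n ^ 'n \<Rightarrow> bool"
  where "has_normal_law M y \<mu> \<Sigma> \<longleftrightarrow> y \<in> borel_measurable M \<and>
    (\<exists>A :: real ^ 'n ^ 'n. A ** transpose A = \<Sigma> \<and>
      distr M borel y = distr std_normal_vec borel (\<lambda>z. \<mu> + A *v z))"

text \<open>The chi-squared law: the sum of the squares of \<open>d\<close> independent standard normal variables.\<close>

definition chi_squared :: "nat \<Rightarrow> real measure"
  where "chi_squared d =
    distr (\<Pi>\<^sub>M i\<in>{..<d}. std_normal_distribution) borel (\<lambda>z. \<Sum>i<d. (z i)\<^sup>2)"

definition chi_squared_cdf :: "nat \<Rightarrow> real \<Rightarrow> real"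
  where "chi_squared_cdf d = cdf (chi_squared d)"

text \<open>
  For \<open>d \<ge> 1\<close> the distribution function is a bijection from \<open>{0..}\<close> onto \<open>{0..<1}\<close>; it vanishes on
  the negative half-line, so it is inverted on \<open>{0..}\<close> only.
\<close>

definition chi_squared_cdf_inv :: "nat \<Rightarrow> real \<Rightarrow> real"
  where "chi_squared_cdf_inv d = the_inv_into {0..} (chi_squared_cdf d)"

definition Psi_inv :: "nat \<Rightarrow> real \<Rightarrow> real"
  where "Psi_inv d \<beta> = sqrt (chi_squared_cdf_inv d (1 - \<beta>))"

lemma measurable_vec_lambda_PiM [measurable]:
  "(\<lambda>z. \<chi> i. z i) \<in> (\<Pi>\<^sub>M i\<in>UNIV. std_normal_distribution) \<rightarrow>\<^sub>M (borel :: (real ^ 'n) measure)"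
proof (subst borel_measurable_euclidean_space, intro ballI)
  fix b :: "real ^ 'n"
  assume "b \<in> Basis"
  then obtain k where b: "b = axis k 1"
    by (auto simp: Basis_vec_def)
  have "(\<lambda>z. z k) \<in> (\<Pi>\<^sub>M i\<in>(UNIV :: 'n set). std_normal_distribution) \<rightarrow>\<^sub>M std_normal_distribution"
    by (rule measurable_component_singleton) simp
  then show "(\<lambda>z. (\<chi> i. z i) \<bullet> b) \<in> borel_measurable (\<Pi>\<^sub>M i\<in>(UNIV :: 'n set). std_normal_distribution)"
    by (simp add: b inner_axis cong: measurable_cong_sets)
qed

lemma measurable_affine_vec:
  fixes A :: "real ^ 'n ^ 'm"
  shows "(\<lambda>z. \<mu> + A *v z) \<in> borel_measurable borel"
  by (intro borel_measurable_continuous_onI continuous_intros matrix_vector_mult_linear_continuous_on)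

lemma std_normal_distribution_moments:
  "integrable std_normal_distribution (\<lambda>x. x)" "integral\<^sup>L std_normal_distribution (\<lambda>x. x) = 0"
  "integrable std_normal_distribution (\<lambda>x. x\<^sup>2)" "integral\<^sup>L std_normal_distribution (\<lambda>x. x\<^sup>2) = 1"
  using integrable_std_normal_moment[of 1] integrable_std_normal_moment[of 2]
    integral_std_normal_moment_odd[of 0] integral_std_normal_moment_even[of 1]
  by (auto simp: integral_density integrable_density normal_density_nonneg fact_2)

lemma std_normal_vec_second_moment:
  fixes k l :: "'n::finite"
  shows "integrable std_normal_vec (\<lambda>z :: real ^ 'n. z $ k * z $ l)"
    "integral\<^sup>L std_normal_vec (\<lambda>z :: real ^ 'n. z $ k * z $ l) = (if k = l then 1 else 0)"
proof -
  interpret N: prob_space std_normal_distribution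
    using prob_space_normal_density[of 1 0] by simp
  interpret product_prob_space "\<lambda>_ :: 'n. std_normal_distribution" UNIV ..
  define f :: "'n \<Rightarrow> real \<Rightarrow> real"
    where "f i x = (if i = k then x else 1) * (if i = l then x else 1)" for i x
  have f: "(\<Prod>i\<in>UNIV. f i (z i)) = z k * z l" for z
    by (simp add: f_def prod.distrib)
  have ff: "f i = (if i = k \<and> i = l then (\<lambda>x. x\<^sup>2) else if i = k \<or> i = l then (\<lambda>x. x) else (\<lambda>_. 1))" for i
    by (auto simp: f_def power2_eq_square)
  have int: "integrable std_normal_distribution (f i)" for i
    using std_normal_distribution_moments by (simp add: ff)
  have val: "integral\<^sup>L std_normal_distribution (f i) =
      (if i = k \<and> i = l then 1 else if i = k \<or> i = l then 0 else 1)" for i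
    using std_normal_distribution_moments N.prob_space by (simp add: ff)
  show "integrable std_normal_vec (\<lambda>z :: real ^ 'n. z $ k * z $ l)"
    using product_integrable_prod[of UNIV f] int
    by (simp add: std_normal_vec_def integrable_distr_eq f)
  have "integral\<^sup>L std_normal_vec (\<lambda>z :: real ^ 'n. z $ k * z $ l) =
      (\<Prod>i\<in>UNIV. integral\<^sup>L std_normal_distribution (f i))"
    using product_integral_prod[of UNIV f] int
    by (simp add: std_normal_vec_def integral_distr f)
  also have "\<dots> = (if k = l then 1 else 0)"
    by (auto simp: val intro!: prod.neutral)
  finally show "integral\<^sup>L std_normal_vec (\<lambda>z :: real ^ 'n. z $ k * z $ l) = (if k = l then 1 else 0)" .
qed

lemma std_normal_vec_first_moment:
  fixes k :: "'n::finite"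
  shows "integrable std_normal_vec (\<lambda>z :: real ^ 'n. z $ k)"
    "integral\<^sup>L std_normal_vec (\<lambda>z :: real ^ 'n. z $ k) = 0"
proof -
  interpret N: prob_space std_normal_distribution
    using prob_space_normal_density[of 1 0] by simp
  interpret product_prob_space "\<lambda>_ :: 'n. std_normal_distribution" UNIV ..
  have comp: "distr (\<Pi>\<^sub>M i\<in>(UNIV :: 'n set). std_normal_distribution) std_normal_distribution (\<lambda>z. z k)
      = std_normal_distribution"
    using PiM_component[of k] by simp
  have meas: "(\<lambda>z. z k) \<in> (\<Pi>\<^sub>M i\<in>(UNIV :: 'n set). std_normal_distribution) \<rightarrow>\<^sub>M std_normal_distribution"
    by (rule measurable_component_singleton) simp
  show "integrable std_normal_vec (\<lambda>z :: real ^ 'n. z $ k)"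
    using integrable_distr[OF meas, unfolded comp, OF std_normal_distribution_moments(1)]
    by (simp add: std_normal_vec_def integrable_distr_eq)
  show "integral\<^sup>L std_normal_vec (\<lambda>z :: real ^ 'n. z $ k) = 0"
    using integral_distr[OF meas, of "\<lambda>x. x", unfolded comp] std_normal_distribution_moments(2)
    by (simp add: std_normal_vec_def integral_distr[OF measurable_vec_lambda_PiM])
qed

lemma prob_space_std_normal_vec: "prob_space (std_normal_vec :: (real ^ 'n) measure)"
proof -
  interpret N: prob_space std_normal_distribution
    using prob_space_normal_density[of 1 0] by simp
  interpret product_prob_space "\<lambda>_ :: 'n. std_normal_distribution" UNIV ..
  show ?thesis
    unfolding std_normal_vec_def by (rule prob_space_distr) simp
qed

lemma has_normal_law_mean:
  fixes y :: "'w \<Rightarrow> real ^ ('n::finite)"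
  assumes "has_normal_law M y \<mu> \<Sigma>"
  shows "integrable M (\<lambda>\<omega>. y \<omega> $ i)" "integral\<^sup>L M (\<lambda>\<omega>. y \<omega> $ i) = \<mu> $ i"
proof -
  from assms obtain A :: "real ^ 'n ^ 'n" where y: "y \<in> borel_measurable M"
    and A: "distr M borel y = distr std_normal_vec borel (\<lambda>z. \<mu> + A *v z)"
    by (auto simp: has_normal_law_def)
  interpret prob_space "std_normal_vec :: (real ^ 'n) measure"
    by (rule prob_space_std_normal_vec)
  have m: "(\<lambda>z. \<mu> + A *v z) \<in> borel_measurable std_normal_vec"
    using measurable_affine_vec by (simp add: std_normal_vec_def)
  have comp: "(\<mu> + A *v z) $ i = \<mu> $ i + (\<Sum>k\<in>UNIV. A $ i $ k * z $ k)" for z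
    by (simp add: matrix_vector_mult_def)
  show "integrable M (\<lambda>\<omega>. y \<omega> $ i)"
    using integrable_distr_eq[OF y, of "\<lambda>v. v $ i"] integrable_distr_eq[OF m, of "\<lambda>v. v $ i"]
    by (simp add: A comp std_normal_vec_first_moment del: vector_add_component)
  show "integral\<^sup>L M (\<lambda>\<omega>. y \<omega> $ i) = \<mu> $ i"
    using integral_distr[OF y, of "\<lambda>v. v $ i"] integral_distr[OF m, of "\<lambda>v. v $ i"]
    by (simp add: A comp std_normal_vec_first_moment prob_space del: vector_add_component)
qed

lemma has_normal_law_covariance:
  fixes y :: "'w \<Rightarrow> real ^ ('n::finite)"
  assumes "has_normal_law M y \<mu> \<Sigma>"
  shows "integrable M (\<lambda>\<omega>. (y \<omega> $ i - \<mu> $ i) * (y \<omega> $ j - \<mu> $ j))"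
    "integral\<^sup>L M (\<lambda>\<omega>. (y \<omega> $ i - \<mu> $ i) * (y \<omega> $ j - \<mu> $ j)) = \<Sigma> $ i $ j"
proof -
  from assms obtain A :: "real ^ 'n ^ 'n" where y: "y \<in> borel_measurable M" and S: "\<Sigma> = A ** transpose A"
    and A: "distr M borel y = distr std_normal_vec borel (\<lambda>z. \<mu> + A *v z)"
    by (auto simp: has_normal_law_def)
  have m: "(\<lambda>z. \<mu> + A *v z) \<in> borel_measurable std_normal_vec"
    using measurable_affine_vec by (simp add: std_normal_vec_def)
  define g :: "real ^ 'n \<Rightarrow> real" where "g v = (v $ i - \<mu> $ i) * (v $ j - \<mu> $ j)" for v
  have g: "g \<in> borel_measurable borel"
    unfolding g_def by measurable
  have comp: "g (\<mu> + A *v z) = (\<Sum>k\<in>UNIV. \<Sum>l\<in>UNIV. A $ i $ k * A $ j $ l * (z $ k * z $ l))" for z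
    by (simp add: g_def matrix_vector_mult_def sum_product mult_ac)
  have "integrable M (\<lambda>\<omega>. g (y \<omega>))"
    using integrable_distr_eq[OF y g] integrable_distr_eq[OF m g]
    by (simp add: A comp std_normal_vec_second_moment)
  then show "integrable M (\<lambda>\<omega>. (y \<omega> $ i - \<mu> $ i) * (y \<omega> $ j - \<mu> $ j))"
    by (simp add: g_def)
  have "integral\<^sup>L M (\<lambda>\<omega>. g (y \<omega>)) = (\<Sum>k\<in>UNIV. \<Sum>l\<in>UNIV. A $ i $ k * A $ j $ l * (if k = l then 1 else 0))"
    using integral_distr[OF y g] integral_distr[OF m g]
    by (simp add: A comp std_normal_vec_second_moment)
  also have "\<dots> = \<Sigma> $ i $ j"
    by (simp add: S matrix_matrix_mult_def transpose_def if_distrib cong: if_cong)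
  finally show "integral\<^sup>L M (\<lambda>\<omega>. (y \<omega> $ i - \<mu> $ i) * (y \<omega> $ j - \<mu> $ j)) = \<Sigma> $ i $ j"
    by (simp add: g_def)
qed

end

theory Submission
  imports Defs
begin

text \<open>
  Write \<open>y = ybar + A z\<close> with \<open>z\<close> standard normal, and let \<open>c = (Psi_inv d \<beta>)\<^sup>2\<close> be the
  \<open>(1 - \<beta>)\<close>-quantile of the chi-squared law. Since the \<open>i\<close>-th row of \<open>A\<close> has norm \<open>\<sigma> $ i\<close>, by
  Cauchy-Schwarz the ball \<open>\<parallel>z\<parallel>\<^sup>2 \<le> c\<close>, which has probability \<open>1 - \<beta>\<close>, is contained in the event
  \<open>y \<le> 0\<close>.
\<close>

section \<open>Null sets and positivity for the standard normal law on the line\<close>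

lemma prob_space_std_normal_distribution: "prob_space std_normal_distribution"
  using prob_space_normal_density[of 1 0] by simp

lemma emeasure_std_normal_singleton: "emeasure std_normal_distribution {a} = 0"
proof -
  have "AE x in lborel. x \<in> {a} \<longrightarrow> ennreal (std_normal_density x) = 0"
    by (rule AE_mp[OF AE_lborel_singleton[of a]]) auto
  then have "{a} \<in> null_sets std_normal_distribution"
    by (subst null_sets_density_iff) auto
  then show ?thesis by auto
qed

text \<open>The density is strictly positive, so an interval that is null for the normal law would
  also be null for Lebesgue measure.\<close>

lemma emeasure_std_normal_interval_pos:
  assumes "a < b"
  shows "emeasure std_normal_distribution {a<..<b} > 0"
proof (rule ccontr)
  have not_pos: "\<not> std_normal_density x \<le> 0" for x
    by (simp add: not_le normal_density_pos)
  assume "\<not> ?thesis"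
  then have "{a<..<b} \<in> null_sets std_normal_distribution"
    by (auto simp: null_sets_def)
  then have "AE x in lborel. x \<in> {a<..<b} \<longrightarrow> ennreal (std_normal_density x) = 0"
    by (subst (asm) null_sets_density_iff) auto
  then have "AE x in lborel. x \<notin> {a<..<b}"
    by (rule eventually_mono) (auto simp: ennreal_eq_0_iff not_pos)
  then have "emeasure lborel {a<..<b} = 0"
    by (subst (asm) AE_iff_measurable[where N="{a<..<b}"]) auto
  with assms show False by simp
qed

lemma measurable_sum_squares [measurable]:
  "(\<lambda>z. \<Sum>i\<in>I. (z i)\<^sup>2) \<in> borel_measurable (\<Pi>\<^sub>M i\<in>I. std_normal_distribution)"
proof (intro borel_measurable_sum borel_measurable_power)
  fix i assume "i \<in> I"
  then have "(\<lambda>z. z i) \<in> (\<Pi>\<^sub>M i\<in>I. std_normal_distribution) \<rightarrow>\<^sub>M std_normal_distribution"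
    by (rule measurable_component_singleton)
  then show "(\<lambda>z. z i) \<in> borel_measurable (\<Pi>\<^sub>M i\<in>I. std_normal_distribution)"
    by (simp cong: measurable_cong_sets)
qed

section \<open>The chi-squared law and the inverse of its distribution function\<close>

lemma real_distribution_chi_squared: "real_distribution (chi_squared d)"
proof -
  interpret prob_space "\<Pi>\<^sub>M i\<in>{..<d}. std_normal_distribution"
    by (intro prob_space_PiM prob_space_std_normal_distribution)
  show ?thesis
    unfolding chi_squared_def by (rule real_distribution_distr) simp
qed

text \<open>Integrate out the last coordinate first: once the others are fixed, at most two values
  of it make the sum of squares equal to \<open>a\<close>, and points are null for the normal law.
  For \<open>d = 0\<close> the law is a point mass at 0, so \<open>d \<ge> 1\<close> is
  essential.\<close>

lemma chi_squared_singleton: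
  assumes "d \<ge> 1"
  shows "measure (chi_squared d) {a} = 0"
proof -
  interpret N: prob_space std_normal_distribution
    by (rule prob_space_std_normal_distribution)
  interpret product_prob_space "\<lambda>_ :: nat. std_normal_distribution" UNIV ..
  obtain n where d: "d = Suc n"
    using assms by (cases d) auto
  let ?P = "\<lambda>d. \<Pi>\<^sub>M i\<in>{..<d}. std_normal_distribution"
  let ?f = "\<lambda>z. indicator {a} (\<Sum>i<d. (z i)\<^sup>2) :: ennreal"
  have "emeasure (chi_squared d) {a} = (\<integral>\<^sup>+ z. ?f z \<partial>?P d)"
    unfolding chi_squared_def
    by (subst nn_integral_distr[where f="indicator {a}" and M'=borel, symmetric]) auto
  also have "\<dots> = (\<integral>\<^sup>+ z. (\<integral>\<^sup>+ x. ?f (z(n := x)) \<partial>std_normal_distribution) \<partial>?P n)"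
    unfolding d lessThan_Suc by (rule product_nn_integral_insert) auto
  also have "\<dots> = (\<integral>\<^sup>+ z. 0 \<partial>?P n)"
  proof (rule nn_integral_cong)
    fix z :: "nat \<Rightarrow> real"
    \<comment> \<open>If the radicand is negative, \<open>?r\<close> is not a genuine root, but then
      no \<open>x\<close> makes the sum equal to \<open>a\<close>. If it is zero, the two indicators
      below coincide, which the upper bound tolerates.\<close>
    let ?r = "sqrt (a - (\<Sum>i<n. (z i)\<^sup>2))"
    have "(\<integral>\<^sup>+ x. ?f (z(n := x)) \<partial>std_normal_distribution)
        \<le> (\<integral>\<^sup>+ x. indicator {?r} x + indicator {-?r} x \<partial>std_normal_distribution)"
    proof (rule nn_integral_mono)
      fix x :: real
      have "x = ?r \<or> x = - ?r" if "(\<Sum>i<d. ((z(n := x)) i)\<^sup>2) = a"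
      proof -
        have "x\<^sup>2 = a - (\<Sum>i<n. (z i)\<^sup>2)"
          using that by (simp add: d)
        then have "?r = \<bar>x\<bar>"
          by (metis real_sqrt_abs)
        then show ?thesis by auto
      qed
      then show "?f (z(n := x)) \<le> indicator {?r} x + indicator {-?r} x"
        by (auto simp: indicator_def)
    qed
    also have "\<dots> = 0"
      by (subst nn_integral_add) (auto simp: emeasure_std_normal_singleton)
    finally show "(\<integral>\<^sup>+ x. ?f (z(n := x)) \<partial>std_normal_distribution) = 0"
      by simp
  qed
  finally show ?thesis
    by (simp add: measure_def)
qed

text \<open>It suffices to find a cube of positive product measure on which the sum of squares stays
  between \<open>a\<close> and \<open>b\<close>. This yields strict monotonicity of the distribution
  function on the nonnegative half-line.\<close>

lemma chi_squared_interval_pos: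
  assumes "d \<ge> 1" "0 \<le> a" "a < b"
  shows "measure (chi_squared d) {a<..b} > 0"
proof -
  interpret N: prob_space std_normal_distribution
    by (rule prob_space_std_normal_distribution)
  interpret product_prob_space "\<lambda>_ :: nat. std_normal_distribution" UNIV ..
  interpret C: real_distribution "chi_squared d"
    by (rule real_distribution_chi_squared)
  let ?P = "\<Pi>\<^sub>M i\<in>{..<d}. std_normal_distribution"
  \<comment> \<open>Each square is to lie strictly between \<open>a / d\<close> and
    \<open>b / d\<close>, so that the \<open>d\<close> of them add up to a value between
    \<open>a\<close> and \<open>b\<close>.\<close>
  let ?I = "{sqrt (a / d)<..<sqrt (b / d)}"
  have d: "real d > 0" using assms by simp
  have "sqrt (a / d) < sqrt (b / d)"
    using d \<open>a < b\<close> by (simp add: divide_strict_right_mono)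
  then have "emeasure std_normal_distribution ?I > 0"
    by (rule emeasure_std_normal_interval_pos)
  then have "0 < (\<Prod>i<d. emeasure std_normal_distribution ?I)"
    unfolding prod_constant zero_less_iff_neq_zero by (rule power_not_zero)
  also have "\<dots> = emeasure ?P (\<Pi>\<^sub>E i\<in>{..<d}. ?I)"
    by (subst emeasure_PiM) auto
  also have "\<dots> \<le> emeasure ?P ((\<lambda>z. \<Sum>i<d. (z i)\<^sup>2) -` {a<..b} \<inter> space ?P)"
  proof (rule emeasure_mono)
    show "(\<Pi>\<^sub>E i\<in>{..<d}. ?I) \<subseteq> (\<lambda>z. \<Sum>i<d. (z i)\<^sup>2) -` {a<..b} \<inter> space ?P"
    proof
      fix z assume z: "z \<in> (\<Pi>\<^sub>E i\<in>{..<d}. ?I)"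
      have *: "a / d < (z i)\<^sup>2" "(z i)\<^sup>2 < b / d" if "i < d" for i
      proof -
        have "z i \<in> ?I"
          using that by (intro PiE_mem[OF z]) simp
        then have i: "sqrt (a / d) < z i" "z i < sqrt (b / d)"
          by simp_all
        \<comment> \<open>This makes \<open>z i\<close> positive, hence the square root of its own
          square, and comparisons of roots become comparisons of squares.\<close>
        have "0 \<le> sqrt (a / d)"
          using \<open>0 \<le> a\<close> by (intro real_sqrt_ge_zero divide_nonneg_nonneg) simp_all
        with i(1) have "sqrt ((z i)\<^sup>2) = z i"
          by (intro real_sqrt_unique) linarith+
        with i show "a / d < (z i)\<^sup>2" "(z i)\<^sup>2 < b / d"
          by (metis real_sqrt_less_iff)+
      qed
      have ne: "{..<d} \<noteq> {}" using assms by (auto simp: lessThan_empty_iff)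
      have "(\<Sum>i<d. a / d) < (\<Sum>i<d. (z i)\<^sup>2)" "(\<Sum>i<d. (z i)\<^sup>2) < (\<Sum>i<d. b / d)"
        using ne by (intro sum_strict_mono; simp add: *)+
      then show "z \<in> (\<lambda>z. \<Sum>i<d. (z i)\<^sup>2) -` {a<..b} \<inter> space ?P"
        using d z by (auto simp: space_PiM)
    qed
  qed (auto intro: measurable_sets)
  also have "\<dots> = emeasure (chi_squared d) {a<..b}"
    unfolding chi_squared_def by (subst emeasure_distr) auto
  finally show ?thesis
    by (simp add: C.emeasure_eq_measure)
qed

lemma isCont_chi_squared_cdf: "d \<ge> 1 \<Longrightarrow> isCont (chi_squared_cdf d) x"
proof -
  assume d: "d \<ge> 1"
  interpret C: real_distribution "chi_squared d"
    by (rule real_distribution_chi_squared)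
  show ?thesis
    using C.isCont_cdf[of x] chi_squared_singleton[OF d] by (simp add: chi_squared_cdf_def)
qed

lemma strict_mono_on_chi_squared_cdf:
  assumes "d \<ge> 1"
  shows "strict_mono_on {0..} (chi_squared_cdf d)"
proof (rule strict_mono_onI)
  interpret C: real_distribution "chi_squared d"
    by (rule real_distribution_chi_squared)
  fix a b :: real assume "a \<in> {0..}" "b \<in> {0..}" "a < b"
  then show "chi_squared_cdf d a < chi_squared_cdf d b"
    using C.cdf_diff_eq[of a b] chi_squared_interval_pos[OF assms, of a b]
    by (simp add: chi_squared_cdf_def)
qed

text \<open>A sum of squares is nonnegative, so all mass on \<open>{..0}\<close> sits at the point
  0, which is not an atom.\<close>

lemma chi_squared_cdf_0:
  assumes "d \<ge> 1"
  shows "chi_squared_cdf d 0 = 0"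
proof -
  let ?P = "\<Pi>\<^sub>M i\<in>{..<d}. std_normal_distribution"
  have "measure (chi_squared d) {..0} = measure (chi_squared d) {0}"
    unfolding chi_squared_def
    by (subst (1 2) measure_distr) (auto intro!: arg_cong[where f="measure ?P"] antisym sum_nonneg)
  then show ?thesis
    using chi_squared_singleton[OF assms] by (simp add: chi_squared_cdf_def cdf_def)
qed

text \<open>\<open>the_inv_into\<close> is meaningful only for an injective function and a value in
  its image. Injectivity comes from strict monotonicity, membership in the image from the
  intermediate value theorem.\<close>

lemma chi_squared_cdf_inv:
  assumes "d \<ge> 1" "0 \<le> p" "p < 1"
  shows "0 \<le> chi_squared_cdf_inv d p" "chi_squared_cdf d (chi_squared_cdf_inv d p) = p"
proof -
  interpret C: real_distribution "chi_squared d"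
    by (rule real_distribution_chi_squared)
  have "eventually (\<lambda>x. p < chi_squared_cdf d x) at_top"
    using order_tendstoD(1)[OF C.cdf_lim_at_top_prob assms(3)] by (simp add: chi_squared_cdf_def)
  then obtain B where B: "\<And>x. x \<ge> B \<Longrightarrow> p < chi_squared_cdf d x"
    by (auto simp: eventually_at_top_linorder)
  \<comment> \<open>The distribution function is 0 at 0 and exceeds \<open>p\<close> at
    \<open>max 0 B\<close>; the maximum ensures that the right endpoint is not below 0.\<close>
  have "\<exists>x\<ge>0. x \<le> max 0 B \<and> chi_squared_cdf d x = p"
    using assms B[of "max 0 B"]
    by (intro IVT') (auto simp: chi_squared_cdf_0 intro!: continuous_at_imp_continuous_on
        isCont_chi_squared_cdf)
  then have p: "p \<in> chi_squared_cdf d ` {0..}"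
    by auto
  have inj: "inj_on (chi_squared_cdf d) {0..}"
    using strict_mono_on_chi_squared_cdf[OF assms(1)] by (rule strict_mono_on_imp_inj_on)
  show "0 \<le> chi_squared_cdf_inv d p"
    using the_inv_into_into[OF inj p order.refl] by (simp add: chi_squared_cdf_inv_def)
  show "chi_squared_cdf d (chi_squared_cdf_inv d p) = p"
    using f_the_inv_into_f[OF inj p] by (simp add: chi_squared_cdf_inv_def)
qed

section \<open>The squared norm of a standard normal vector\<close>

lemma distr_std_normal_vec_norm_squared:
  "distr std_normal_vec borel (\<lambda>z :: real ^ 'n. (norm z)\<^sup>2) = chi_squared CARD('n)"
proof -
  interpret N: prob_space std_normal_distribution
    by (rule prob_space_std_normal_distribution)
  let ?N = "\<lambda>I. \<Pi>\<^sub>M i\<in>I. std_normal_distribution"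
  let ?d = "CARD('n)"
  \<comment> \<open>The vector has coordinates indexed by \<open>'n\<close>, the chi-squared law by
    \<open>{..<?d}\<close>. Relabelling along \<open>t\<close> carries one product of identical
    factors to the other and leaves the sum of squares unchanged.\<close>
  obtain t :: "nat \<Rightarrow> 'n" where t: "bij_betw t {..<?d} UNIV"
    using ex_bij_betw_nat_finite[of "UNIV :: 'n set"] by (auto simp: lessThan_atLeast0)
  interpret P: product_prob_space "\<lambda>_ :: 'n. std_normal_distribution" UNIV ..
  define g where "g z = (\<lambda>k\<in>{..<?d}. z (t k))" for z :: "'n \<Rightarrow> real"
  have distr_g: "distr (?N UNIV) (?N {..<?d}) g = ?N {..<?d}"
    unfolding g_def using P.distr_reorder[of t "{..<?d}" UNIV] t by (simp add: bij_betw_def)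
  have g [measurable]: "g \<in> ?N UNIV \<rightarrow>\<^sub>M ?N {..<?d}"
    unfolding g_def by measurable
  have norm_eq: "(norm (\<chi> i. z i))\<^sup>2 = (\<Sum>k<?d. (g z k)\<^sup>2)" for z :: "'n \<Rightarrow> real"
    using sum.reindex_bij_betw[OF t, of "\<lambda>i. (z i)\<^sup>2"]
    by (simp add: g_def norm_vec_def L2_set_def sum_nonneg)
  have "distr std_normal_vec borel (\<lambda>z :: real ^ 'n. (norm z)\<^sup>2)
      = distr (?N UNIV) borel (\<lambda>z. \<Sum>k<?d. (g z k)\<^sup>2)"
    unfolding std_normal_vec_def
    by (subst distr_distr) (auto simp: o_def norm_eq)
  also have "\<dots> = distr (distr (?N UNIV) (?N {..<?d}) g) borel (\<lambda>z. \<Sum>k<?d. (z k)\<^sup>2)"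
    by (subst distr_distr) (auto simp: o_def)
  also have "\<dots> = chi_squared ?d"
    unfolding distr_g chi_squared_def ..
  finally show ?thesis .
qed

lemma measure_std_normal_vec_ball:
  "measure std_normal_vec {z :: real ^ 'n. (norm z)\<^sup>2 \<le> c} = chi_squared_cdf CARD('n) c"
proof -
  have "chi_squared_cdf CARD('n) c = measure (distr std_normal_vec borel (\<lambda>z :: real ^ 'n. (norm z)\<^sup>2)) {..c}"
    by (simp add: chi_squared_cdf_def cdf_def distr_std_normal_vec_norm_squared)
  also have "\<dots> = measure std_normal_vec {z :: real ^ 'n. (norm z)\<^sup>2 \<le> c}"
    by (subst measure_distr) (auto simp: std_normal_vec_def vimage_def)
  finally show ?thesis ..
qed

theorem theorem2:
  fixes M :: "'w measure"
    and y :: "'w \<Rightarrow> real ^ 'n"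
    and ybar \<sigma> :: "real ^ 'n"
    and \<Sigma> :: "real ^ 'n ^ 'n"
    and \<beta> :: real
  assumes "prob_space M"
    and "has_normal_law M y ybar \<Sigma>"
    and "0 < \<beta>" and "\<beta> < 1"
    and "\<And>i. \<sigma> $ i = sqrt (\<Sigma> $ i $ i)"
    and "ybar + Psi_inv CARD('n) \<beta> *\<^sub>R \<sigma> \<le> 0"
  shows "measure M {\<omega> \<in> space M. y \<omega> \<le> 0} \<ge> 1 - \<beta>"
proof -
  from assms(2) obtain A :: "real ^ 'n ^ 'n" where y: "y \<in> borel_measurable M"
    and \<Sigma>: "\<Sigma> = A ** transpose A"
    and A: "distr M borel y = distr std_normal_vec borel (\<lambda>z. ybar + A *v z)"
    by (auto simp: has_normal_law_def)
  interpret S: prob_space "std_normal_vec :: (real ^ 'n) measure"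
    by (rule prob_space_std_normal_vec)
  let ?r = "Psi_inv CARD('n) \<beta>"
  let ?c = "chi_squared_cdf_inv CARD('n) (1 - \<beta>)"
  have d: "CARD('n) \<ge> 1"
    by (simp add: Suc_leI)
  have c: "0 \<le> ?c" "chi_squared_cdf CARD('n) ?c = 1 - \<beta>"
    using chi_squared_cdf_inv[OF d, of "1 - \<beta>"] assms(3,4) by auto
  have closed: "closed {v :: real ^ 'n. v \<le> 0}"
    by (simp add: less_eq_vec_def closed_Collect_all closed_Collect_le continuous_on_component)
  then have L [measurable]: "{v :: real ^ 'n. v \<le> 0} \<in> sets borel"
    by (rule borel_closed)
  have m: "(\<lambda>z. ybar + A *v z) \<in> borel_measurable std_normal_vec"
    using measurable_affine_vec by (simp add: std_normal_vec_def)
  \<comment> \<open>The diagonal entry \<open>\<Sigma> $ i $ i\<close> is the inner product of row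
    \<open>i\<close> of \<open>A\<close> with itself.\<close>
  have row: "norm (A $ i) = \<sigma> $ i" for i
    by (simp add: assms(5) \<Sigma> matrix_matrix_mult_def transpose_def norm_vec_def L2_set_def
        power2_eq_square)
  have nonpos: "ybar + A *v z \<le> 0" if z: "(norm z)\<^sup>2 \<le> ?c" for z
  proof -
    have "norm z \<le> ?r"
      using z by (simp add: Psi_inv_def real_le_rsqrt)
    have "(ybar + A *v z) $ i \<le> 0" for i
    proof -
      have "(A *v z) $ i = A $ i \<bullet> z"
        by (simp add: matrix_vector_mult_def inner_vec_def)
      also have "\<dots> \<le> norm (A $ i) * norm z"
        by (rule norm_cauchy_schwarz)
      \<comment> \<open>Reading \<open>\<sigma> $ i\<close> as a norm supplies the nonnegativity
        needed to multiply the bound on \<open>norm z\<close>.\<close>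
      also have "\<dots> \<le> \<sigma> $ i * ?r"
        using \<open>norm z \<le> ?r\<close> by (simp add: row[symmetric] mult_left_mono)
      finally have "(ybar + A *v z) $ i \<le> (ybar + ?r *\<^sub>R \<sigma>) $ i"
        by (simp add: mult.commute)
      also have "\<dots> \<le> 0"
        using assms(6) by (simp add: less_eq_vec_def)
      finally show ?thesis .
    qed
    then show ?thesis
      by (simp add: less_eq_vec_def)
  qed
  have "1 - \<beta> = measure std_normal_vec {z :: real ^ 'n. (norm z)\<^sup>2 \<le> ?c}"
    by (simp add: measure_std_normal_vec_ball c)
  also have "\<dots> \<le> measure std_normal_vec ((\<lambda>z. ybar + A *v z) -` {v. v \<le> 0} \<inter> space std_normal_vec)"
    using measurable_sets[OF m L] nonpos
    by (intro S.finite_measure_mono) (auto simp: std_normal_vec_def)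
  \<comment> \<open>The event depends on \<open>y\<close> alone, so equality of laws moves its
    probability back to \<open>M\<close>.\<close>
  also have "\<dots> = measure (distr M borel y) {v. v \<le> 0}"
    by (simp add: A measure_distr[OF m L])
  also have "\<dots> = measure M {\<omega> \<in> space M. y \<omega> \<le> 0}"
    by (simp add: measure_distr[OF y L] vimage_def Int_def conj_commute)
  finally show ?thesis .
qed

end
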